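(* Let $p$ be an odd prime and $a,b\in\mathbb{Z}_p$. If $\langle a\rangle_p>\langle b\rangle_p$, then $$\sum_{k=0}^{p-1}\binom ak\binom{b-a}k\equiv \frac{(-1)^{\langle a\rangle_p-\langle b\rangle_p-1}}{(\langle a\rangle_p-\langle b\rangle_p)\binom{\langle a\rangle_p}{\langle b\rangle_p}}\,(b-\langle b\rangle_p)\pmod{p^2}.$$ If $\langle a\rangle_p\le\langle b\rangle_p$, then $$\sum_{k=0}^{p-1}\binom ak\binom{b-a}k\equiv \binom{\langle b\rangle_p}{\langle a\rangle_p}\Big(1+(b-\langle b\rangle_p)H_{\langle b\rangle_p}-(a-\langle a\rangle_p)H_{\langle a\rangle_p}-(b-a-\langle b-a\rangle_p)H_{\langle b-a\rangle_p}\Big)\pmod{p^2}.$$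
   Context: $\mathbb{Z}_p$ denotes the set of rational $p$-integers, i.e. rational numbers whose denominator is not divisible by $p$; congruences are in $\mathbb{Z}_p$. For $c\in\mathbb{Z}_p$, $\langle c\rangle_p\in\{0,1,\ldots,p-1\}$ is the least nonnegative residue of $c$ modulo $p$. $\binom ak=a(a-1)\cdots(a-k+1)/k!$ (with $\binom a0=1$). $H_n=1+\frac12+\cdots+\frac1n$ for $n\ge 1$, and $H_0=0$. *)

theory Defs
  imports Complex_Main "HOL-Computational_Algebra.Primes"
begin

(* quotient_of returns the fraction in lowest terms, with positive denominator. *)
definition p_integers :: "nat \<Rightarrow> rat set" where
  "p_integers p = {x. \<not> int p dvd snd (quotient_of x)}"

(* Congruence modulo m in the ring of rational p-integers; both sides are
   required to belong to that ring. *)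
definition p_cong :: "nat \<Rightarrow> nat \<Rightarrow> rat \<Rightarrow> rat \<Rightarrow> bool" where
  "p_cong p m x y \<longleftrightarrow>
     x \<in> p_integers p \<and> y \<in> p_integers p \<and> (\<exists>z \<in> p_integers p. x - y = of_nat m * z)"

(* For p prime and c a rational p-integer, this lies in {0, ..., p - 1}. *)
definition least_res :: "nat \<Rightarrow> rat \<Rightarrow> nat" where
  "least_res p c = (LEAST r. p_cong p p c (of_nat r))"

(* The library's harm needs a real normed field, which rat is not. *)
definition harmonic :: "nat \<Rightarrow> rat" where
  "harmonic n = (\<Sum>j = 1..n. 1 / of_nat j)"

end

theory Submission
  imports Defs "HOL-Computational_Algebra.Formal_Power_Series"
begin

text \<open>Write \<open>y = b - a\<close> and let \<open>m\<close>, \<open>n\<close>, \<open>r\<close> be the least residues of \<open>a\<close>, \<open>b\<close>, \<open>y\<close>. The sum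
  \<open>F(a, y) = (\<Sum>k<p. (a gchoose k) * (y gchoose k))\<close> is additively separable modulo
  \<open>p\<^sup>2\<close> around the point \<open>(m, r)\<close>:
  \<open>F(a, y) \<equiv> F(a, r) + F(m, y) - F(m, r)\<close>. Indeed the difference of the two sides is the sum of
  the products \<open>((a gchoose k) - (m gchoose k)) * ((y gchoose k) - (r gchoose k))\<close>, and both
  factors are divisible by \<open>p\<close>, because for \<open>k < p\<close> the residue of \<open>a gchoose k\<close> modulo \<open>p\<close> depends
  only on that of \<open>a\<close> (\<open>p_cong_mult_separate\<close>, \<open>p_cong_gbinomial\<close>).

  Each of the three values on the right has an argument that is a natural number below \<open>p\<close>, so
  that the truncation at \<open>p\<close> is harmless and Vandermonde's convolution evaluates it as one
  binomial coefficient, \<open>F(m, y) = (m + y) gchoose m\<close> (\<open>gbinomial_convolution_truncated\<close>). As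
  \<open>m + r\<close> is \<open>n\<close> or \<open>n + p\<close>, the upper argument has the form \<open>n + e\<close> with \<open>p\<close> dividing \<open>e\<close>.

  What remains is the first order expansion of \<open>(n + e) gchoose k\<close> in \<open>e\<close>. For \<open>k \<le> n\<close> no factor
  of the falling factorial vanishes modulo \<open>p\<close> and its logarithmic derivative is a difference of
  harmonic numbers (\<open>gbinomial_expansion_le\<close>); for \<open>k > n\<close> the single factor \<open>e\<close> vanishes
  modulo \<open>p\<close>, and the others may be taken modulo \<open>p\<close> (\<open>gbinomial_expansion_gt\<close>). When
  \<open>m > n\<close>, the expansions of \<open>F(a, r)\<close> and \<open>F(m, y)\<close> have coefficients that look different, one
  depending on \<open>r\<close> and the other on \<open>m\<close>; evaluating \<open>F(m, r)\<close> in both ways shows that they agree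
  modulo \<open>p\<close>.\<close>

section \<open>Binomial identities in characteristic zero\<close>

lemma gbinomial_Suc_eq_mult:
  fixes x :: "'a :: field_char_0"
  shows "x gchoose Suc k = (x gchoose k) * ((x - of_nat k) / of_nat (Suc k))"
  by (simp add: gbinomial_prod_rev)

lemma gbinomial_add_Suc_eq_mult:
  fixes x e :: "'a :: field_char_0"
  shows "(x + e) gchoose Suc k =
           ((x + e) gchoose k) * ((x - of_nat k + e) * (1 / of_nat (Suc k)))"
proof -
  have "x + e - of_nat k = x - of_nat k + e"
    by simp
  then show ?thesis
    by (simp add: gbinomial_Suc_eq_mult)
qed

text \<open>The terms with \<open>k > m\<close> vanish, and reversing the lower index in \<open>m gchoose k\<close> turns the
  rest into a Vandermonde convolution.\<close>

lemma gbinomial_convolution_truncated: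
  fixes x :: "'a :: field_char_0"
  assumes "m \<le> N"
  shows "(\<Sum>k = 0..N. (of_nat m gchoose k) * (x gchoose k)) = (of_nat m + x) gchoose m"
proof -
  have "(\<Sum>k = 0..N. (of_nat m gchoose k) * (x gchoose k)) =
        (\<Sum>k = 0..m. (of_nat m gchoose k) * (x gchoose k))"
    using assms by (intro sum.mono_neutral_right) (auto simp flip: binomial_gbinomial)
  also have "\<dots> = (\<Sum>k = 0..m. (x gchoose k) * (of_nat m gchoose (m - k)))"
  proof (intro sum.cong refl)
    fix k assume "k \<in> {0..m}"
    then have "m choose k = m choose (m - k)"
      by (simp add: binomial_symmetric[symmetric])
    then show "(of_nat m gchoose k) * (x gchoose k) = (x gchoose k) * (of_nat m gchoose (m - k))"
      by (simp flip: binomial_gbinomial)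
  qed
  also have "\<dots> = (x + of_nat m) gchoose m"
    by (rule gbinomial_Vandermonde)
  finally show ?thesis
    by (simp add: add.commute)
qed

lemma harmonic_Suc: "harmonic (Suc n) = harmonic n + 1 / of_nat (Suc n)"
  by (simp add: harmonic_def)

section \<open>The ring of rational p-integers\<close>

context
  fixes p :: nat
  assumes prime_p: "prime p"
begin

lemma p_integers_iff:
  "x \<in> p_integers p \<longleftrightarrow> (\<exists>u v. \<not> int p dvd v \<and> x = of_int u / of_int v)"
proof
  assume "x \<in> p_integers p"
  then show "\<exists>u v. \<not> int p dvd v \<and> x = of_int u / of_int v"
    unfolding p_integers_def
    by (metis (mono_tags) mem_Collect_eq prod.collapse quotient_of_div)
next
  assume "\<exists>u v. \<not> int p dvd v \<and> x = of_int u / of_int v"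
  then obtain u v where v: "\<not> int p dvd v" and x: "x = of_int u / of_int v"
    by blast
  obtain c d where cd: "quotient_of x = (c, d)"
    by fastforce
  have d: "d > 0" and cop: "coprime c d" and x': "x = of_int c / of_int d"
    using cd quotient_of_denom_pos quotient_of_coprime quotient_of_div by auto
  have "v \<noteq> 0"
    using v by auto
  with x x' d have "(of_int (c * v) :: rat) = of_int (u * d)"
    by (simp add: field_simps)
  then have eq: "c * v = u * d"
    by (simp only: of_int_eq_iff)
  have "\<not> int p dvd d"
  proof
    assume pd: "int p dvd d"
    then have "int p dvd c * v"
      by (simp add: eq)
    with v prime_p have "int p dvd c"
      by (simp add: prime_dvd_mult_iff)
    with pd cop have "is_unit (int p)"
      by (meson coprime_common_divisor)
    with prime_p show False
      by (simp add: prime_nat_iff)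
  qed
  then show "x \<in> p_integers p"
    by (simp add: p_integers_def cd)
qed

lemma p_integers_of_int [simp]: "of_int i \<in> p_integers p"
  using prime_p prime_nat_iff[of p] by (simp add: p_integers_def)

lemma p_integers_of_nat [simp]: "of_nat i \<in> p_integers p"
  using p_integers_of_int[of "int i"] by simp

lemma p_integers_0_1 [simp]: "0 \<in> p_integers p" "1 \<in> p_integers p"
  using p_integers_of_int[of 0] p_integers_of_int[of 1] by auto

lemma p_integers_inverse_of_nat:
  assumes "\<not> p dvd j"
  shows "1 / of_nat j \<in> p_integers p"
  using assms unfolding p_integers_iff
  by (intro exI[of _ 1] exI[of _ "int j"]) simp

lemma p_integers_mult [simp]:
  assumes "x \<in> p_integers p" "y \<in> p_integers p"
  shows "x * y \<in> p_integers p"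
proof -
  obtain u v u' v' where *: "\<not> int p dvd v" "x = of_int u / of_int v"
      "\<not> int p dvd v'" "y = of_int u' / of_int v'"
    using assms unfolding p_integers_iff by blast
  then have "\<not> int p dvd v * v'" "x * y = of_int (u * u') / of_int (v * v')"
    using prime_p by (auto simp: prime_dvd_mult_iff)
  then show ?thesis
    unfolding p_integers_iff by blast
qed

lemma p_integers_add [simp]:
  assumes "x \<in> p_integers p" "y \<in> p_integers p"
  shows "x + y \<in> p_integers p"
proof -
  obtain u v u' v' where *: "\<not> int p dvd v" "x = of_int u / of_int v"
      "\<not> int p dvd v'" "y = of_int u' / of_int v'"
    using assms unfolding p_integers_iff by blast
  moreover have "v \<noteq> 0" "v' \<noteq> 0"
    using * by auto
  ultimately have "\<not> int p dvd v * v'" "x + y = of_int (u * v' + u' * v) / of_int (v * v')"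
    using prime_p by (auto simp: prime_dvd_mult_iff field_simps)
  then show ?thesis
    unfolding p_integers_iff by blast
qed

lemma p_integers_minus [simp]: "x \<in> p_integers p \<Longrightarrow> - x \<in> p_integers p"
  using p_integers_mult[of "of_int (- 1)" x, OF p_integers_of_int] by simp

lemma p_integers_diff [simp]:
  "x \<in> p_integers p \<Longrightarrow> y \<in> p_integers p \<Longrightarrow> x - y \<in> p_integers p"
  using p_integers_add[of x "- y"] by simp

lemma p_integers_power [simp]: "x \<in> p_integers p \<Longrightarrow> x ^ k \<in> p_integers p"
  by (induction k) auto

lemma p_integers_sum:
  "(\<And>i. i \<in> A \<Longrightarrow> f i \<in> p_integers p) \<Longrightarrow> sum f A \<in> p_integers p"
  by (induction A rule: infinite_finite_induct) auto

lemma p_integers_divide_of_nat: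
  assumes "x \<in> p_integers p" "0 < j" "j < p"
  shows "x / of_nat j \<in> p_integers p"
  using p_integers_mult[OF assms(1) p_integers_inverse_of_nat[of j]] nat_dvd_not_less[OF assms(2,3)]
  by simp

lemma p_integers_harmonic:
  assumes "n < p"
  shows "harmonic n \<in> p_integers p"
  unfolding harmonic_def using assms
  by (intro p_integers_sum p_integers_divide_of_nat) auto

lemma p_integers_gbinomial:
  assumes "x \<in> p_integers p" "k < p"
  shows "x gchoose k \<in> p_integers p"
  using assms(2)
proof (induction k)
  case (Suc k)
  then show ?case
    unfolding gbinomial_Suc_eq_mult using assms(1)
    by (intro p_integers_mult p_integers_divide_of_nat) auto
qed simp

section \<open>Congruences between p-integers\<close>

lemma p_congI:
  "x = y + of_nat N * z \<Longrightarrow> y \<in> p_integers p \<Longrightarrow> z \<in> p_integers p \<Longrightarrow> p_cong p N x y"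
  unfolding p_cong_def by auto

lemma p_congE:
  assumes "p_cong p N x y"
  obtains z where "x = y + of_nat N * z" "y \<in> p_integers p" "z \<in> p_integers p"
proof -
  obtain z where "x - y = of_nat N * z" "y \<in> p_integers p" "z \<in> p_integers p"
    using assms unfolding p_cong_def by auto
  then show ?thesis
    by (intro that[of z]) (auto simp: algebra_simps)
qed

lemma p_cong_refl: "x \<in> p_integers p \<Longrightarrow> p_cong p N x x"
  by (rule p_congI[where z = 0]) auto

lemma p_cong_sym: "p_cong p N x y \<Longrightarrow> p_cong p N y x"
  by (erule p_congE, rule_tac z = "- z" in p_congI) auto

lemma p_cong_trans [trans]:
  assumes "p_cong p N x y" "p_cong p N y z"
  shows "p_cong p N x z"
proof -
  from assms obtain v w where "x = y + of_nat N * v" "y = z + of_nat N * w"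
      and "z \<in> p_integers p" "v \<in> p_integers p" "w \<in> p_integers p"
    by (metis p_congE)
  then show ?thesis
    by (intro p_congI[where z = "v + w"]) (auto simp: algebra_simps)
qed

lemma p_cong_add:
  assumes "p_cong p N x x'" "p_cong p N y y'"
  shows "p_cong p N (x + y) (x' + y')"
proof -
  from assms obtain v w where "x = x' + of_nat N * v" "y = y' + of_nat N * w"
      and "x' \<in> p_integers p" "y' \<in> p_integers p" "v \<in> p_integers p" "w \<in> p_integers p"
    by (metis p_congE)
  then show ?thesis
    by (intro p_congI[where z = "v + w"]) (auto simp: algebra_simps)
qed

lemma p_cong_mult:
  assumes "p_cong p N x x'" "p_cong p N y y'"
  shows "p_cong p N (x * y) (x' * y')"
proof -
  from assms obtain v w where "x = x' + of_nat N * v" "y = y' + of_nat N * w"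
      and "x' \<in> p_integers p" "y' \<in> p_integers p" "v \<in> p_integers p" "w \<in> p_integers p"
    by (metis p_congE)
  then show ?thesis
    by (intro p_congI[where z = "v * y' + x' * w + of_nat N * v * w"]) (auto simp: algebra_simps)
qed

lemma p_cong_minus: "p_cong p N x y \<Longrightarrow> p_cong p N (- x) (- y)"
  by (erule p_congE, rule_tac z = "- z" in p_congI) auto

lemma p_cong_diff:
  "p_cong p N x x' \<Longrightarrow> p_cong p N y y' \<Longrightarrow> p_cong p N (x - y) (x' - y')"
  using p_cong_add[of N x x' "- y" "- y'"] p_cong_minus by auto

lemma p_cong_sum:
  "(\<And>i. i \<in> A \<Longrightarrow> p_cong p N (f i) (g i)) \<Longrightarrow> p_cong p N (sum f A) (sum g A)"
  by (induction A rule: infinite_finite_induct) (auto intro: p_cong_add p_cong_refl)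

text \<open>The error is the product \<open>(x - x') * (y - y')\<close> of two multiples of \<open>N\<close>.\<close>

lemma p_cong_mult_separate:
  assumes "p_cong p N x x'" "p_cong p N y y'"
  shows "p_cong p (N ^ 2) (x * y) (x * y' + x' * y - x' * y')"
proof -
  from assms obtain v w where "x = x' + of_nat N * v" "y = y' + of_nat N * w"
      and "x' \<in> p_integers p" "y' \<in> p_integers p" "v \<in> p_integers p" "w \<in> p_integers p"
    by (metis p_congE)
  then show ?thesis
    by (intro p_congI[where z = "v * w"]) (auto simp: algebra_simps power2_eq_square)
qed

text \<open>The recurrence from \<open>k\<close> to \<open>k + 1\<close> divides only by \<open>k + 1 < p\<close>, whose inverse is a p-integer; this is
  where the truncation of the sum at \<open>p\<close> enters.\<close>

lemma p_cong_gbinomial: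
  assumes "p_cong p N x y" "k < p"
  shows "p_cong p N (x gchoose k) (y gchoose k)"
  using assms(2)
proof (induction k)
  case (Suc k)
  have "p_cong p N (x - of_nat k) (y - of_nat k)"
    by (intro p_cong_diff assms(1) p_cong_refl) simp
  moreover have "p_cong p N (1 / of_nat (Suc k)) (1 / of_nat (Suc k))"
    using Suc.prems by (intro p_cong_refl p_integers_divide_of_nat) auto
  ultimately have "p_cong p N ((x - of_nat k) * (1 / of_nat (Suc k)))
                              ((y - of_nat k) * (1 / of_nat (Suc k)))"
    by (rule p_cong_mult)
  then have "p_cong p N ((x - of_nat k) / of_nat (Suc k)) ((y - of_nat k) / of_nat (Suc k))"
    by simp
  with Suc show ?case
    unfolding gbinomial_Suc_eq_mult by (intro p_cong_mult) auto
qed (simp add: p_cong_refl)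

lemma p_cong_of_nat_imp_dvd:
  assumes "p_cong p p (of_nat i) (of_nat j)"
  shows "int p dvd int i - int j"
proof -
  obtain z where z: "of_nat i = of_nat j + of_nat p * z" "z \<in> p_integers p"
    using assms by (rule p_congE)
  then obtain u v where v: "\<not> int p dvd v" and "z = of_int u / of_int v"
    unfolding p_integers_iff by blast
  moreover have "v \<noteq> 0"
    using v by auto
  ultimately have "of_int ((int i - int j) * v) = (of_int (int p * u) :: rat)"
    using z by (simp add: field_simps)
  then have "(int i - int j) * v = int p * u"
    by (simp only: of_int_eq_iff)
  then have "int p dvd (int i - int j) * v"
    by simp
  with v prime_p show ?thesis
    by (simp add: prime_dvd_mult_iff)
qed

text \<open>A denominator prime to \<open>p\<close> is invertible modulo \<open>p\<close> by Bezout's identity, hence every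
  p-integer is congruent to an integer.\<close>

lemma ex_residue:
  assumes "c \<in> p_integers p"
  shows "\<exists>r < p. p_cong p p c (of_nat r)"
proof -
  obtain u v where v: "\<not> int p dvd v" and c: "c = of_int u / of_int v"
    using assms unfolding p_integers_iff by blast
  have "coprime v (int p)"
    using v prime_p prime_imp_coprime[of "int p" v] by (simp add: coprime_commute)
  then obtain s t where st: "s * v + t * int p = 1"
    using bezout_int[of v "int p"] by auto
  define i where "i = u * s"
  define r where "r = nat (i mod int p)"
  have p0: "p > 0"
    using prime_p by (rule prime_gt_0_nat)
  have r: "int r = i mod int p"
    using p0 by (simp add: r_def)
  have "i = int r + int p * (i div int p)"
    by (simp add: r)
  then have "(of_int i :: rat) = of_int (int r + int p * (i div int p))"
    by simp
  then have i: "(of_int i :: rat) = of_nat r + of_nat p * of_int (i div int p)"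
    by simp
  have "v \<noteq> 0"
    using v by auto
  have "(of_int u :: rat) = of_int (u * (s * v + t * int p))"
    by (simp add: st)
  then have "c = of_int i + of_nat p * (of_int (u * t) * (1 / of_int v))"
    using \<open>v \<noteq> 0\<close> by (simp add: c i_def field_simps)
  then have "c = of_nat r + of_nat p * (of_int (i div int p) + of_int (u * t) * (1 / of_int v))"
    by (simp only: i algebra_simps)
  moreover have "1 / of_int v \<in> p_integers p"
    unfolding p_integers_iff using v by (metis of_int_1)
  ultimately have "p_cong p p c (of_nat r)"
    by (intro p_congI[where z = "of_int (i div int p) + of_int (u * t) * (1 / of_int v)"]
        p_integers_add p_integers_mult p_integers_of_int p_integers_of_nat)
  moreover have "r < p"
    using p0 r by (metis of_nat_0_less_iff of_nat_less_iff pos_mod_bound)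
  ultimately show ?thesis
    by blast
qed

lemma least_res_cong: "c \<in> p_integers p \<Longrightarrow> p_cong p p c (of_nat (least_res p c))"
  unfolding least_res_def using ex_residue by (metis LeastI)

lemma least_res_less: "c \<in> p_integers p \<Longrightarrow> least_res p c < p"
  unfolding least_res_def using ex_residue by (meson Least_le le_less_trans)

section \<open>First order expansion of binomial coefficients\<close>

text \<open>With \<open>e = p * w\<close>, passing from \<open>m\<close> to \<open>m + 1\<close> multiplies by \<open>(n - m + e) / (m + 1)\<close>. For
  \<open>m < n\<close> the number \<open>n - m\<close> is a unit modulo \<open>p\<close>, so this factor is its value at \<open>e = 0\<close> times
  \<open>1 + e / (n - m)\<close>. Modulo \<open>e\<^sup>2\<close> the first order terms \<open>1 / (n - m)\<close> add up to a difference of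
  harmonic numbers.\<close>

lemma gbinomial_expansion_le:
  assumes "w \<in> p_integers p" "n < p" "m \<le> n"
  shows "p_cong p (p ^ 2) ((of_nat n + of_nat p * w) gchoose m)
           ((of_nat n gchoose m) * (1 + of_nat p * w * (harmonic n - harmonic (n - m))))"
  using assms(3)
proof (induction m)
  case 0
  show ?case
    by (simp add: p_cong_refl)
next
  case (Suc m)
  define e where "e = of_nat p * w"
  define C where "C = (of_nat n gchoose m :: rat)"
  define h where "h = harmonic n - harmonic (n - m)"
  define d where "d = (of_nat (n - m) :: rat)"
  have d: "d = of_nat n - of_nat m" "d \<noteq> 0"
    using Suc.prems by (auto simp: d_def of_nat_diff)
  have "n - m = Suc (n - Suc m)"
    using Suc.prems by simp
  then have h': "harmonic n - harmonic (n - Suc m) = h + 1 / d"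
    unfolding h_def d_def by (simp only: harmonic_Suc diff_diff_eq2)
  have R: "w \<in> p_integers p" "C \<in> p_integers p" "h \<in> p_integers p" "1 / d \<in> p_integers p"
      "e \<in> p_integers p" "d \<in> p_integers p" "1 / of_nat (Suc m) \<in> p_integers p"
    unfolding C_def h_def d_def e_def using assms Suc.prems
    by (auto intro!: p_integers_gbinomial p_integers_harmonic p_integers_divide_of_nat
          p_integers_diff simp del: of_nat_Suc of_nat_diff)
  have R': "(d + e) * (1 / of_nat (Suc m)) \<in> p_integers p"
    using R by (intro p_integers_mult p_integers_add)
  have "(of_nat n + e) gchoose Suc m =
      ((of_nat n + e) gchoose m) * ((d + e) * (1 / of_nat (Suc m)))"
    unfolding d(1) by (rule gbinomial_add_Suc_eq_mult)
  also have "p_cong p (p ^ 2) \<dots> ((C * (1 + e * h)) * ((d + e) * (1 / of_nat (Suc m))))"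
    using Suc R' by (intro p_cong_mult p_cong_refl) (auto simp: C_def e_def h_def)
  also have "p_cong p (p ^ 2) \<dots> ((C * (d * (1 / of_nat (Suc m)))) * (1 + e * (h + 1 / d)))"
  proof (rule p_congI)
    show "C * (1 + e * h) * ((d + e) * (1 / of_nat (Suc m))) =
        (C * (d * (1 / of_nat (Suc m)))) * (1 + e * (h + 1 / d)) +
        of_nat (p ^ 2) * (w ^ 2 * h * C * (1 / of_nat (Suc m)))"
      using d by (simp add: e_def divide_simps del: of_nat_Suc)
        (simp add: algebra_simps power2_eq_square)
  qed (intro p_integers_mult p_integers_add p_integers_power p_integers_0_1 R)+
  also have "(C * (d * (1 / of_nat (Suc m)))) * (1 + e * (h + 1 / d)) =
      (of_nat n gchoose Suc m) * (1 + e * (harmonic n - harmonic (n - Suc m)))"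
    by (simp add: gbinomial_Suc_eq_mult C_def d h')
  finally show ?case
    by (simp add: e_def)
qed

text \<open>The coefficient in the expansion below is a p-integer because \<open>m choose n\<close> divides the factorial
  of \<open>m\<close> and \<open>0 < m - n \<le> m < p\<close>.\<close>

lemma p_integers_expansion_coefficient:
  assumes "n < m" "m < p"
  shows "(-1) ^ k / ((of_nat m - of_nat n) * of_nat (m choose n)) \<in> p_integers p"
proof -
  have "(m choose n) dvd fact m"
    using binomial_fact_lemma[of n m] assms by (metis dvd_triv_right less_imp_le)
  then have "\<not> p dvd (m choose n)"
    using assms(2) prime_p by (meson dvd_trans leD prime_dvd_fact_iff)
  moreover have "\<not> p dvd m - n"
    using assms by (auto dest: dvd_imp_le)
  ultimately have "\<not> p dvd (m - n) * (m choose n)"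
    using prime_p by (simp add: prime_dvd_mult_iff)
  then have "(-1) ^ k * (1 / of_nat ((m - n) * (m choose n))) \<in> p_integers p"
    by (intro p_integers_mult p_integers_inverse_of_nat p_integers_power) simp_all
  then show ?thesis
    using assms by (simp add: of_nat_diff)
qed

text \<open>The step from \<open>n\<close> to \<open>n + 1\<close> contributes the factor \<open>e / (n + 1)\<close>, where \<open>e = p * w\<close>. Since
  \<open>p\<close> divides \<open>e\<close>, every other factor matters only modulo \<open>p\<close>: the earlier ones give
  \<open>n gchoose n = 1\<close>, and each later one, for \<open>m > n\<close>, is \<open>(n - m) / (m + 1)\<close>. The sign counts the
  later factors.\<close>

lemma gbinomial_expansion_gt:
  assumes "w \<in> p_integers p" "n < m" "m < p"
  shows "p_cong p (p ^ 2) ((of_nat n + of_nat p * w) gchoose m)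
           ((-1) ^ (m - n - 1) / ((of_nat m - of_nat n) * of_nat (m choose n)) * (of_nat p * w))"
  using assms(2,3)
proof (induction m)
  case 0
  then show ?case
    by simp
next
  case (Suc m)
  define e where "e = of_nat p * w"
  have eR: "e \<in> p_integers p"
    using assms by (simp add: e_def)
  have inv: "1 / of_nat (Suc m) \<in> p_integers p"
    using Suc.prems by (intro p_integers_divide_of_nat) auto
  show ?case
  proof (cases "m = n")
    case True
    have "(of_nat n + e) gchoose Suc m = ((of_nat n + e) gchoose n) * (e * (1 / of_nat (Suc n)))"
      by (simp add: gbinomial_Suc_eq_mult True)
    also obtain z where z: "(of_nat n + e) gchoose n = 1 + of_nat p * z" "z \<in> p_integers p"
    proof -
      have "p_cong p p (of_nat n + e) (of_nat n)"
        using assms by (intro p_congI[where z = w]) (auto simp: e_def)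
      then have "p_cong p p ((of_nat n + e) gchoose n) (of_nat n gchoose n)"
        using Suc.prems True by (intro p_cong_gbinomial) auto
      then show ?thesis
        using that by (auto elim!: p_congE simp flip: binomial_gbinomial)
    qed
    have "p_cong p (p ^ 2) (((of_nat n + e) gchoose n) * (e * (1 / of_nat (Suc n))))
                 (e * (1 / of_nat (Suc n)))"
    proof (rule p_congI)
      show "((of_nat n + e) gchoose n) * (e * (1 / of_nat (Suc n))) =
          e * (1 / of_nat (Suc n)) + of_nat (p ^ 2) * (z * w * (1 / of_nat (Suc n)))"
        unfolding z(1) by (simp add: e_def algebra_simps power2_eq_square add_divide_distrib
            del: of_nat_Suc)
    qed (intro p_integers_mult inv[unfolded True] eR z(2) assms(1))+
    finally show ?thesis
      by (simp add: True e_def)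
  next
    case False
    with Suc.prems have nm: "n < m" "m < p"
      by auto
    define c where "c = (-1) ^ (m - n - 1) / ((of_nat m - of_nat n) * of_nat (m choose n) :: rat)"
    have cR: "c \<in> p_integers p"
      unfolding c_def using nm by (rule p_integers_expansion_coefficient)
    have IH: "p_cong p (p ^ 2) ((of_nat n + e) gchoose m) (c * e)"
      using Suc.IH nm by (simp add: c_def e_def)
    have "(of_nat n + e) gchoose Suc m =
        ((of_nat n + e) gchoose m) * ((of_nat n - of_nat m + e) * (1 / of_nat (Suc m)))"
    by (rule gbinomial_add_Suc_eq_mult)
    also have "p_cong p (p ^ 2) \<dots> ((c * e) * ((of_nat n - of_nat m + e) * (1 / of_nat (Suc m))))"
      using IH inv eR by (intro p_cong_mult[OF IH] p_cong_refl p_integers_mult) auto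
    also have "p_cong p (p ^ 2) \<dots> (c * (of_nat n - of_nat m) * (1 / of_nat (Suc m)) * e)"
    proof (rule p_congI)
      show "(c * e) * ((of_nat n - of_nat m + e) * (1 / of_nat (Suc m))) =
          c * (of_nat n - of_nat m) * (1 / of_nat (Suc m)) * e +
          of_nat (p ^ 2) * (c * w ^ 2 * (1 / of_nat (Suc m)))"
        by (simp add: e_def algebra_simps power2_eq_square add_divide_distrib diff_divide_distrib
            del: of_nat_Suc)
    qed (intro p_integers_mult p_integers_diff p_integers_power p_integers_of_nat inv cR eR assms(1))+
    also have "c * (of_nat n - of_nat m) * (1 / of_nat (Suc m)) =
        (-1) ^ (Suc m - n - 1) / ((of_nat (Suc m) - of_nat n) * of_nat (Suc m choose n))"
    proof -
      have "(Suc m - n) * (Suc m choose n) = Suc m * (m choose n)"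
        using nm binomial_absorb_comp[of "Suc m" n] by simp
      then have "of_nat ((Suc m - n) * (Suc m choose n)) = (of_nat (Suc m * (m choose n)) :: rat)"
        by simp
      then have *: "(of_nat (Suc m) - of_nat n) * of_nat (Suc m choose n) =
          (of_nat (Suc m) * of_nat (m choose n) :: rat)"
        using nm by (simp only: of_nat_mult of_nat_diff less_imp_le less_SucI)
      have "Suc m - n - 1 = Suc (m - n - 1)"
        using nm by simp
      moreover have "(of_nat m :: rat) - of_nat n \<noteq> 0" "m choose n \<noteq> 0"
        using nm by auto
      ultimately show ?thesis
        unfolding * c_def by (simp add: divide_simps del: of_nat_Suc) (simp add: algebra_simps)
    qed
    finally show ?thesis
      by (simp add: e_def)
  qed
qed

section \<open>Reduction of the sum to residues\<close>

lemma gbinomial_sum_separate: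
  assumes "p_cong p p a a'" "p_cong p p y y'"
  defines "F \<equiv> \<lambda>a y. \<Sum>k = 0..p - 1. (a gchoose k) * (y gchoose k)"
  shows "p_cong p (p ^ 2) (F a y) (F a y' + F a' y - F a' y')"
proof -
  have "k < p" if "k \<in> {0..p - 1}" for k
    using that prime_gt_0_nat[OF prime_p] by auto
  then show ?thesis
    unfolding F_def sum.distrib[symmetric] sum_subtractf[symmetric]
    by (intro p_cong_sum p_cong_mult_separate p_cong_gbinomial assms)
qed

lemma gbinomial_sum_least_res:
  assumes a: "a \<in> p_integers p" and y: "y \<in> p_integers p"
  defines "m \<equiv> least_res p a" and "r \<equiv> least_res p y"
  shows "p_cong p (p ^ 2) (\<Sum>k = 0..p - 1. (a gchoose k) * (y gchoose k))
           (((of_nat r + a) gchoose r) + ((of_nat m + y) gchoose m)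
             - (of_nat (m + r) gchoose m))"
proof -
  have le: "m \<le> p - 1" "r \<le> p - 1"
    using least_res_less[OF a] least_res_less[OF y] by (auto simp: m_def r_def)
  have "(\<Sum>k = 0..p - 1. (a gchoose k) * (of_nat r gchoose k)) = (of_nat r + a) gchoose r"
    using gbinomial_convolution_truncated[OF le(2), of a] by (simp add: mult.commute)
  with gbinomial_sum_separate[OF least_res_cong[OF a] least_res_cong[OF y]] show ?thesis
    using gbinomial_convolution_truncated[OF le(1), of y]
      gbinomial_convolution_truncated[OF le(1), of "of_nat r :: rat"] by (simp add: m_def r_def)
qed

text \<open>This is \<open>b \<equiv> a + (b - a)\<close> read off on least residues, with a carry exactly when the residue of
  \<open>a\<close> exceeds that of \<open>b\<close>.\<close>

lemma least_res_diff:
  assumes "a \<in> p_integers p" "b \<in> p_integers p"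
  shows "least_res p a + least_res p (b - a) =
           (if least_res p a \<le> least_res p b then least_res p b else least_res p b + p)"
proof -
  define m n r where "m = least_res p a" and "n = least_res p b" and "r = least_res p (b - a)"
  have less: "m < p" "n < p" "r < p"
    unfolding m_def n_def r_def by (intro least_res_less p_integers_diff assms)+
  have "p_cong p p (of_nat m + of_nat r) (a + (b - a))"
    unfolding m_def r_def
    by (rule p_cong_add; rule p_cong_sym; intro least_res_cong p_integers_diff assms)
  also have "p_cong p p (a + (b - a)) (of_nat n)"
    unfolding n_def using assms by (simp add: least_res_cong)
  finally have "int p dvd int (m + r) - int n"
    by (intro p_cong_of_nat_imp_dvd) simp
  then obtain q where q: "int (m + r) - int n = int p * q"
    by (rule dvdE)
  \<comment> \<open>From \<open>0 \<le> m + r < 2 * p\<close> and \<open>0 \<le> n < p\<close> the quotient \<open>q\<close> is 0 or 1.\<close>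
  have "int p * q < int p * 2" "int p * (-1) < int p * q"
    unfolding q[symmetric] using less by linarith+
  moreover have "int p > 0"
    using less by linarith
  ultimately have "q < 2" "-1 < q"
    by (blast dest: mult_left_less_imp_less[OF _ less_imp_le])+
  then have "q = 0 \<or> q = 1"
    by linarith
  then have "m + r = n \<or> m + r = n + p"
    using q by auto
  then show ?thesis
    using less unfolding m_def[symmetric] n_def[symmetric] r_def[symmetric] by auto
qed

end

section \<open>The sum modulo the square of p\<close>

theorem theorem4p1:
  fixes p :: nat and a b :: rat
  assumes "prime p" and "odd p"
    and "a \<in> p_integers p" and "b \<in> p_integers p"
  shows "(least_res p a > least_res p b \<longrightarrow>
           p_cong p (p ^ 2)
             (\<Sum>k = 0..p - 1. (a gchoose k) * ((b - a) gchoose k))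
             ((-1) ^ (least_res p a - least_res p b - 1) /
                ((of_nat (least_res p a) - of_nat (least_res p b)) *
                 of_nat (least_res p a choose least_res p b)) *
              (b - of_nat (least_res p b)))) \<and>
         (least_res p a \<le> least_res p b \<longrightarrow>
           p_cong p (p ^ 2)
             (\<Sum>k = 0..p - 1. (a gchoose k) * ((b - a) gchoose k))
             (of_nat (least_res p b choose least_res p a) *
              (1 + (b - of_nat (least_res p b)) * harmonic (least_res p b)
                 - (a - of_nat (least_res p a)) * harmonic (least_res p a)
                 - (b - a - of_nat (least_res p (b - a))) * harmonic (least_res p (b - a)))))"
proof -
  define m n r where "m = least_res p a" and "n = least_res p b" and "r = least_res p (b - a)"
  define S where "S = (\<Sum>k = 0..p - 1. (a gchoose k) * ((b - a) gchoose k))"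
  note prime = assms(1)
  have R: "a \<in> p_integers p" "b - a \<in> p_integers p"
    using assms p_integers_diff by auto
  have less: "m < p" "n < p" "r < p"
    using assms R by (auto simp: m_def n_def r_def intro: least_res_less)
  obtain s where s: "a = of_nat m + of_nat p * s" "s \<in> p_integers p"
    using least_res_cong[OF prime R(1)] unfolding m_def by (rule p_congE[OF prime])
  obtain u where u: "b - a = of_nat r + of_nat p * u" "u \<in> p_integers p"
    using least_res_cong[OF prime R(2)] unfolding r_def by (rule p_congE[OF prime])
  note mr = least_res_diff[OF prime assms(3,4), folded m_def n_def r_def]
  have S: "p_cong p (p ^ 2) S
      (((of_nat r + a) gchoose r) + ((of_nat m + (b - a)) gchoose m) - (of_nat (m + r) gchoose m))"
    unfolding S_def m_def r_def by (rule gbinomial_sum_least_res[OF prime R])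
  have gt: "p_cong p (p ^ 2) S
      ((-1) ^ (m - n - 1) / ((of_nat m - of_nat n) * of_nat (m choose n)) * (b - of_nat n))"
    if nm: "n < m"
  proof -
    define c where "c k = (-1) ^ (k - n - 1) / ((of_nat k - of_nat n) * of_nat (k choose n) :: rat)"
      for k
    have sum_eq: "m + r = n + p"
      using mr nm by simp
    then have nr: "n < r"
      using less by linarith
    have sum_eq': "of_nat r = of_nat n + of_nat p - (of_nat m :: rat)"
      using sum_eq by (metis add_diff_cancel_left' of_nat_add)
    have expand: "p_cong p (p ^ 2) ((of_nat n + of_nat p * w) gchoose k) (c k * (of_nat p * w))"
      if "w \<in> p_integers p" "k \<in> {m, r}" for w k
      unfolding c_def using that nm nr less by (intro gbinomial_expansion_gt[OF prime]) auto
    have one: "1 \<in> p_integers p"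
      using p_integers_0_1(2)[OF prime] .
    have Sr: "p_cong p (p ^ 2) ((of_nat r + a) gchoose r) (c r * (of_nat p * (1 + s)))"
      using expand[of "1 + s" r] s one by (simp add: sum_eq' prime algebra_simps)
    have Sm: "p_cong p (p ^ 2) ((of_nat m + (b - a)) gchoose m) (c m * (of_nat p * (1 + u)))"
      using expand[of "1 + u" m] u one by (simp add: sum_eq' prime algebra_simps)
    have Smr: "p_cong p (p ^ 2) (of_nat (m + r) gchoose m) (c m * of_nat p)"
      using expand[of 1 m] one by (simp add: sum_eq)
    \<comment> \<open>Expanding \<open>(m + r) gchoose m\<close> also as \<open>(m + r) gchoose r\<close> shows that \<open>p * c r\<close> and \<open>p * c m\<close>
      agree modulo \<open>p\<^sup>2\<close>, which replaces a direct comparison of the two coefficients.\<close>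
    have "(of_nat (m + r) gchoose m :: rat) = of_nat (m + r) gchoose r"
      using binomial_symmetric[of r "m + r"] by (simp del: of_nat_add flip: binomial_gbinomial)
    then have "p_cong p (p ^ 2) (of_nat (m + r) gchoose m) (c r * of_nat p)"
      using expand[of 1 r] one by (simp add: sum_eq)
    then have "p_cong p (p ^ 2) (c r * of_nat p) (c m * of_nat p)"
      using Smr p_cong_sym[OF prime] p_cong_trans[OF prime] by blast
    then have "p_cong p (p ^ 2) (c r * of_nat p * (1 + s)) (c m * of_nat p * (1 + s))"
      by (rule p_cong_mult[OF prime _ p_cong_refl[OF prime]])
        (intro p_integers_add[OF prime] one s(2))
    then have "p_cong p (p ^ 2) ((of_nat r + a) gchoose r) (c m * of_nat p * (1 + s))"
      using p_cong_trans[OF prime Sr] by (simp add: mult.assoc)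
    then have "p_cong p (p ^ 2) S
        (c m * of_nat p * (1 + s) + c m * (of_nat p * (1 + u)) - c m * of_nat p)"
      using Sm Smr by (intro p_cong_trans[OF prime S] p_cong_diff[OF prime] p_cong_add[OF prime])
    also have "c m * of_nat p * (1 + s) + c m * (of_nat p * (1 + u)) - c m * of_nat p =
        c m * (b - of_nat n)"
    proof -
      have "b - of_nat n = of_nat p * (1 + s + u)"
        using s u sum_eq' by (simp add: algebra_simps)
      then show ?thesis
        by (simp add: algebra_simps)
    qed
    finally show ?thesis
      by (simp add: c_def)
  qed
  have le: "p_cong p (p ^ 2) S
      (of_nat (n choose m) * (1 + (b - of_nat n) * harmonic n - (a - of_nat m) * harmonic m
         - (b - a - of_nat r) * harmonic r))"
    if mn: "m \<le> n"
  proof -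
    define C where "C = (of_nat (n choose m) :: rat)"
    have sum_eq: "m + r = n"
      using mr mn by simp
    then have diff: "n - m = r" "n - r = m" "r \<le> n"
      by auto
    have C: "of_nat n gchoose m = C" "of_nat n gchoose r = C"
      using mn binomial_symmetric[OF mn] diff by (simp_all add: C_def flip: binomial_gbinomial)
    have sum_eq': "of_nat n = of_nat m + (of_nat r :: rat)"
      by (simp flip: sum_eq)
    have Sr: "p_cong p (p ^ 2) ((of_nat r + a) gchoose r)
        (C * (1 + of_nat p * s * (harmonic n - harmonic m)))"
      using gbinomial_expansion_le[OF prime s(2) less(2) diff(3)]
      by (simp add: diff C s(1)) (simp add: sum_eq' add_ac)
    have Sm: "p_cong p (p ^ 2) ((of_nat m + (b - a)) gchoose m)
        (C * (1 + of_nat p * u * (harmonic n - harmonic r)))"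
      using gbinomial_expansion_le[OF prime u(2) less(2) mn]
      by (simp add: diff C u(1)) (simp add: sum_eq' add_ac)
    have Smr: "p_cong p (p ^ 2) (of_nat (m + r) gchoose m) C"
      unfolding sum_eq C by (simp add: C_def p_cong_refl[OF prime] prime)
    have "p_cong p (p ^ 2) S (C * (1 + of_nat p * s * (harmonic n - harmonic m)) +
        C * (1 + of_nat p * u * (harmonic n - harmonic r)) - C)"
      using Sr Sm Smr
      by (intro p_cong_trans[OF prime S] p_cong_diff[OF prime] p_cong_add[OF prime])
    also have "C * (1 + of_nat p * s * (harmonic n - harmonic m)) +
        C * (1 + of_nat p * u * (harmonic n - harmonic r)) - C =
        C * (1 + (b - of_nat n) * harmonic n - (a - of_nat m) * harmonic m
         - (b - a - of_nat r) * harmonic r)"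
    proof -
      have "b - of_nat n = of_nat p * s + of_nat p * u"
           "a - of_nat m = of_nat p * s" "b - a - of_nat r = of_nat p * u"
        using s u sum_eq' by (simp_all add: algebra_simps)
      then show ?thesis
        by (simp only:) (simp add: algebra_simps)
    qed
    finally show ?thesis
      by (simp add: C_def)
  qed
  show ?thesis
    using gt le unfolding S_def m_def n_def r_def by blast
qed

end
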